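(* Let $n$ and $k$ be positive integers, let $\alpha_1,\ldots,\alpha_n$ be positive real numbers, and let $b_1,\ldots,b_n$ be integers. Let $A_1,\ldots,A_n$ be finite subsets of $\mathbb{Z}$ each of cardinality $k$. For $1\leqslant i<j\leqslant n$ let $m_{ij}$ be an integer greater than $2\max\{|x_i-x_j|:\ x_i\in A_i,\ x_j\in A_j\}$. Then the set $$\Big\{\sum_{i=1}^n a_i:\ a_i\in A_i \text{ for all } i,\ a_i\alpha_i\neq a_j\alpha_j\ \text{and}\ a_i+b_i\not\equiv a_j+b_j \pmod{m_{ij}}\ \text{whenever}\ i<j\Big\}$$ has more than $(k-n)n$ elements. *)

theory Defs
  imports "HOL-Number_Theory.Number_Theory"
begin

end

theory Submission
  imports Defs "Jordan_Normal_Form.Determinant"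
begin

text \<open>
  Since \<open>m i j\<close> exceeds twice every difference, the congruence condition excludes at most one
  value \<open>c i j\<close> of \<open>a j - a i\<close>, so the restrictions are expressed by the nonvanishing of the
  polynomial
  \<open>P = \<Prod>\<^sub>i\<^sub><\<^sub>j (\<alpha>\<^sub>j x\<^sub>j - \<alpha>\<^sub>i x\<^sub>i) (x\<^sub>j - x\<^sub>i - c\<^sub>i\<^sub>j)\<close>.
  If the set of sums had at most \<open>N = (k - n) n\<close> elements, then multiplying \<open>P\<close> by the factors
  \<open>x\<^sub>1 + \<dots> + x\<^sub>n - e\<close>, where \<open>e\<close> runs through \<open>N\<close> values covering this set, would give a polynomial
  of degree \<open>n (k - 1)\<close> vanishing on the whole grid \<open>A\<^sub>1 \<times> \<dots> \<times> A\<^sub>n\<close>. By Lagrange interpolation the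
  coefficient of \<open>\<Prod>\<^sub>i x\<^sub>i\<^bsup>k-1\<^esup>\<close> in such a polynomial is a linear combination of its values on the
  grid, hence zero. But this coefficient depends only on the leading form, and expanding the two
  Vandermonde products shows that it equals
  \<open>N! \<cdot> per (\<alpha>\<^sub>i\<^bsup>j\<^esup>) \<cdot> det (1 / (k - 1 - i - j)!)\<close> with \<open>0 \<le> i, j < n\<close>. The permanent is
  positive, and the determinant is a nonzero multiple of a Vandermonde determinant.
\<close>

section \<open>Vandermonde determinants\<close>

lemma det_mat_sum_permutations:
  "det (mat n n (\<lambda>(i, j). f i j)) =
     (\<Sum>\<sigma> | \<sigma> permutes {..<n}. of_int (sign \<sigma>) * (\<Prod>i<n. f i (\<sigma> i)))"
proof -
  have "mat n n (\<lambda>(i, j). f i j) $$ (i, \<sigma> i) = f i (\<sigma> i)" if "\<sigma> permutes {..<n}" "i < n" for \<sigma> i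
    using that permutes_in_image[of \<sigma> "{..<n}" i] by simp
  then show ?thesis
    by (subst det_def'[of _ n]) (auto simp: atLeast0LessThan intro!: sum.cong prod.cong)
qed

text \<open>The matrix is the Vandermonde matrix times the matrix of coefficients, and the latter is
  upper triangular with unit diagonal because \<open>p j\<close> is monic of degree
  \<open>j\<close>.\<close>

lemma det_monic_columns:
  fixes x :: "nat \<Rightarrow> 'a :: idom"
  assumes "\<And>j. j < n \<Longrightarrow> degree (p j) = j" "\<And>j. j < n \<Longrightarrow> lead_coeff (p j) = 1"
  shows "det (mat n n (\<lambda>(i, j). poly (p j) (x i))) = det (mat n n (\<lambda>(i, j). x i ^ j))"
proof -
  define V where "V = mat n n (\<lambda>(i, j). x i ^ j)"
  define C where "C = mat n n (\<lambda>(i, j). coeff (p j) i)"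
  have V: "V \<in> carrier_mat n n" and C: "C \<in> carrier_mat n n"
    by (simp_all add: V_def C_def)
  have "mat n n (\<lambda>(i, j). poly (p j) (x i)) = V * C"
  proof (rule eq_matI)
    fix i j assume "i < dim_row (V * C)" "j < dim_col (V * C)"
    then have ij: "i < n" "j < n" by (simp_all add: V_def C_def)
    have "poly (p j) (x i) = (\<Sum>l\<le>j. coeff (p j) l * x i ^ l)"
      using assms(1)[OF ij(2)] by (simp add: poly_altdef)
    also have "\<dots> = (\<Sum>l<n. coeff (p j) l * x i ^ l)"
      using ij assms(1)[OF ij(2)]
      by (intro sum.mono_neutral_left) (auto intro!: coeff_eq_0)
    finally show "mat n n (\<lambda>(i, j). poly (p j) (x i)) $$ (i, j) = (V * C) $$ (i, j)"
      using ij by (simp add: V_def C_def scalar_prod_def mult.commute atLeast0LessThan)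
  qed (simp_all add: V_def C_def)
  moreover have "det C = 1"
  proof -
    have "upper_triangular C"
      using assms(1) by (auto simp: upper_triangular_def C_def intro!: coeff_eq_0)
    moreover have "diag_mat C = map (\<lambda>_. 1) [0..<n]"
      using assms by (auto simp: diag_mat_def C_def)
    ultimately show ?thesis
      using det_upper_triangular[OF _ C] by (simp add: map_replicate_const)
  qed
  ultimately show ?thesis
    using det_mult[OF V C] by (simp add: V_def)
qed

lemma det_vandermonde:
  fixes x :: "nat \<Rightarrow> 'a :: idom"
  shows "det (mat n n (\<lambda>(i, j). x i ^ j)) = (\<Prod>j<n. \<Prod>i<j. x j - x i)"
proof (induction n)
  case (Suc n)
  \<comment> \<open>The last column is replaced by the values of the monic polynomial with roots
    \<open>x 0, ..., x (n - 1)\<close>. Its only possibly nonzero entry is the bottom one, so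
    Laplace expansion leaves a single term.\<close>
  define p where "p j = (if j < n then monom 1 j else (\<Prod>l<n. [:- x l, 1:]))" for j
  define M where "M = mat (Suc n) (Suc n) (\<lambda>(i, j). poly (p j) (x i))"
  have M: "M \<in> carrier_mat (Suc n) (Suc n)"
    by (simp add: M_def)
  have last_col: "M $$ (i, n) = (\<Prod>l<n. x i - x l)" if "i \<le> n" for i
    using that by (simp add: M_def p_def poly_prod)
  have zero: "M $$ (i, n) = 0" if "i < n" for i
    using that by (subst last_col) auto
  have "det (mat (Suc n) (Suc n) (\<lambda>(i, j). x i ^ j)) = det M"
    unfolding M_def
  proof (rule det_monic_columns[symmetric])
    fix j assume "j < Suc n"
    then show "degree (p j) = j"
      by (auto simp: p_def degree_monom_eq degree_prod_sum_eq)
    show "lead_coeff (p j) = 1"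
      by (auto simp: p_def degree_monom_eq lead_coeff_prod)
  qed
  also have "\<dots> = (\<Sum>i<Suc n. M $$ (i, n) * cofactor M i n)"
    by (rule laplace_expansion_column[OF M]) simp
  also have "\<dots> = M $$ (n, n) * cofactor M n n"
    using zero by simp
  also have "cofactor M n n = det (mat n n (\<lambda>(i, j). x i ^ j))"
  proof -
    have "mat_delete M n n = mat n n (\<lambda>(i, j). x i ^ j)"
      by (rule eq_matI) (auto simp: mat_delete_def M_def p_def poly_monom)
    then show ?thesis by (simp add: cofactor_def)
  qed
  finally show ?case
    using Suc last_col[of n] by (simp add: mult.commute)
qed (simp add: det_def)

lemma vandermonde_sum_permutations:
  fixes x :: "nat \<Rightarrow> 'a :: idom"
  shows "(\<Prod>j<n. \<Prod>i<j. x j - x i) =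
         (\<Sum>\<sigma> | \<sigma> permutes {..<n}. of_int (sign \<sigma>) * (\<Prod>i<n. x i ^ \<sigma> i))"
  by (simp only: det_vandermonde[symmetric] det_mat_sum_permutations)

section \<open>A coefficient functional on functions on a grid\<close>

text \<open>The weights are those of the divided difference over \<open>S\<close>, built by its recursion.\<close>

lemma top_coefficient_weights:
  fixes S :: "'a :: field set"
  assumes "finite S" "S \<noteq> {}"
  shows "\<exists>w. \<forall>m<card S. (\<Sum>a\<in>S. w a * a ^ m) = of_bool (Suc m = card S)"
  using assms
proof (induction rule: finite_ne_induct)
  case (singleton x)
  show ?case by (rule exI[of _ "\<lambda>_. 1"]) simp
next
  case (insert x S)
  then obtain w where w: "\<And>m. m < card S \<Longrightarrow> (\<Sum>a\<in>S. w a * a ^ m) = of_bool (Suc m = card S)"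
    by blast
  \<comment> \<open>The weight at \<open>x\<close> makes the total weight 0. Summing
    \<open>f\<close> against \<open>v\<close> thus amounts to summing the difference quotients
    \<open>(f a - f x) / (a - x)\<close> against \<open>w\<close>.\<close>
  define v where "v a = (if a = x then - (\<Sum>a\<in>S. w a / (a - x)) else w a / (a - x))" for a
  show ?case
  proof (intro exI[of _ v] allI impI)
    fix m assume "m < card (insert x S)"
    then have m: "m \<le> card S" using insert by simp
    have "(\<Sum>a\<in>insert x S. v a * a ^ m)
        = - (\<Sum>a\<in>S. w a / (a - x)) * x ^ m + (\<Sum>a\<in>S. v a * a ^ m)"
      using insert by (simp add: v_def)
    also have "(\<Sum>a\<in>S. v a * a ^ m) = (\<Sum>a\<in>S. w a / (a - x) * a ^ m)"
      using insert by (intro sum.cong) (auto simp: v_def)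
    also have "- (\<Sum>a\<in>S. w a / (a - x)) * x ^ m + \<dots> = (\<Sum>a\<in>S. w a / (a - x) * (a ^ m - x ^ m))"
      by (simp only: right_diff_distrib sum_subtractf sum_distrib_right[symmetric]) simp
    also have "\<dots> = of_bool (Suc m = card (insert x S))"
    proof (cases m)
      case 0
      then show ?thesis using insert by simp
    next
      case (Suc d)
      \<comment> \<open>The difference quotient of the power \<open>m\<close> is a monic polynomial
        in \<open>a\<close> of degree \<open>d = m - 1\<close>, so by the choice of \<open>w\<close>
        only its leading term can contribute.\<close>
      have "(\<Sum>a\<in>S. w a / (a - x) * (a ^ m - x ^ m))
          = (\<Sum>a\<in>S. w a * (\<Sum>p\<le>d. a ^ p * x ^ (d - p)))"
        using insert unfolding Suc diff_power_eq_sum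
        by (intro sum.cong) (auto simp: lessThan_Suc_atMost)
      also have "\<dots> = (\<Sum>p\<le>d. x ^ (d - p) * (\<Sum>a\<in>S. w a * a ^ p))"
        by (simp add: sum_distrib_left mult_ac) (rule sum.swap)
      also have "\<dots> = (\<Sum>p\<le>d. x ^ (d - p) * of_bool (Suc p = card S))"
        using m Suc by (intro sum.cong) (auto simp: w)
      also have "\<dots> = (\<Sum>p\<le>d. if p = d then of_bool (m = card S) else 0)"
        using m Suc by (intro sum.cong) auto
      finally show ?thesis using insert by simp
    qed
    finally show "(\<Sum>a\<in>insert x S. v a * a ^ m) = of_bool (Suc m = card (insert x S))" .
  qed
qed

section \<open>Monomials and linear forms as functions of real tuples\<close>

definition monomial :: "nat \<Rightarrow> (nat \<Rightarrow> nat) \<Rightarrow> (nat \<Rightarrow> real) \<Rightarrow> real" where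
  "monomial n e a = (\<Prod>i<n. a i ^ e i)"

definition linform :: "nat \<Rightarrow> (nat \<Rightarrow> real) \<Rightarrow> (nat \<Rightarrow> real) \<Rightarrow> real" where
  "linform n \<beta> a = (\<Sum>i<n. \<beta> i * a i)"

lemma monomial_Suc: "i < n \<Longrightarrow> monomial n (e(i := Suc (e i))) a = a i * monomial n e a"
proof -
  assume i: "i < n"
  have "monomial n (e(i := Suc (e i))) a = (\<Prod>l<n. (if l = i then a i else 1) * a l ^ e l)"
    unfolding monomial_def by (intro prod.cong) auto
  then show ?thesis using i by (simp add: prod.distrib monomial_def)
qed

lemma linform_mult_monomial:
  "linform n \<beta> a * monomial n e a = (\<Sum>i<n. \<beta> i * monomial n (e(i := Suc (e i))) a)"
  by (simp add: linform_def sum_distrib_right monomial_Suc mult.assoc)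

lemma sum_exponent_Suc:
  fixes e :: "nat \<Rightarrow> nat"
  assumes "i < n"
  shows "(\<Sum>l<n. (e(i := Suc (e i))) l) = Suc (\<Sum>l<n. e l)"
proof -
  have "(\<Sum>l<n. (e(i := Suc (e i))) l) = (\<Sum>l<n. (if l = i then 1 else 0) + e l)"
    by (intro sum.cong) auto
  then show ?thesis using assms by (simp add: sum.distrib)
qed

text \<open>On polynomials of degree at most \<open>d\<close> in one variable, summation over
  \<open>A i\<close> with weights \<open>w i\<close> extracts the coefficient of the power
  \<open>d\<close>. The application has \<open>d = k - 1\<close>.\<close>

locale weighted_grid =
  fixes n d :: nat and A :: "nat \<Rightarrow> real set" and w :: "nat \<Rightarrow> real \<Rightarrow> real"
  assumes finite_A: "i < n \<Longrightarrow> finite (A i)"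
    and weights: "i < n \<Longrightarrow> m \<le> d \<Longrightarrow> (\<Sum>a\<in>A i. w i a * a ^ m) = of_bool (m = d)"
begin

text \<open>On polynomials of total degree at most \<open>n * d\<close>, \<open>L\<close> reads off
  the coefficient of the monomial with all exponents \<open>d\<close>, since any other monomial of
  such degree has an exponent below \<open>d\<close>.\<close>

definition L :: "((nat \<Rightarrow> real) \<Rightarrow> real) \<Rightarrow> real" where
  "L f = (\<Sum>a\<in>PiE {..<n} A. (\<Prod>i<n. w i (a i)) * f a)"

lemma L_cong: "(\<And>a. a \<in> PiE {..<n} A \<Longrightarrow> f a = g a) \<Longrightarrow> L f = L g"
  unfolding L_def by (intro sum.cong) auto

lemma L_diff: "L (\<lambda>a. f a - g a) = L f - L g"
  by (simp add: L_def right_diff_distrib sum_subtractf)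

lemma L_cmult: "L (\<lambda>a. c * f a) = c * L f"
  by (simp add: L_def sum_distrib_left mult.left_commute)

lemma L_sum: "L (\<lambda>a. \<Sum>x\<in>X. f x a) = (\<Sum>x\<in>X. L (f x))"
  by (simp add: L_def sum_distrib_left) (rule sum.swap)

lemma L_monomial: "L (monomial n e) = (\<Prod>i<n. \<Sum>a\<in>A i. w i a * a ^ e i)"
  by (subst prod_sum_PiE) (simp_all add: L_def monomial_def finite_A prod.distrib)

lemma L_monomial_eq_0:
  assumes "i < n" "e i < d"
  shows "L (monomial n e) = 0"
  unfolding L_monomial using assms weights[of i "e i"] by (intro prod_zero) auto

text \<open>Expanding one affine factor either raises one exponent or contributes the constant. This
  is the recursion behind the inductions on the number of factors.\<close>

lemma L_affine_mult:
  "L (\<lambda>a. monomial n e a * ((linform n \<beta> a - c) * g a)) =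
     (\<Sum>i<n. \<beta> i * L (\<lambda>a. monomial n (e(i := Suc (e i))) a * g a)) - c * L (\<lambda>a. monomial n e a * g a)"
proof -
  have "L (\<lambda>a. monomial n e a * ((linform n \<beta> a - c) * g a))
      = L (\<lambda>a. (\<Sum>i<n. \<beta> i * (monomial n (e(i := Suc (e i))) a * g a)) - c * (monomial n e a * g a))"
  proof (rule L_cong)
    fix a
    have "monomial n e a * ((linform n \<beta> a - c) * g a)
        = (linform n \<beta> a * monomial n e a) * g a - c * (monomial n e a * g a)"
      by (simp add: algebra_simps)
    then show "monomial n e a * ((linform n \<beta> a - c) * g a)
        = (\<Sum>i<n. \<beta> i * (monomial n (e(i := Suc (e i))) a * g a)) - c * (monomial n e a * g a)"
      unfolding linform_mult_monomial by (simp add: sum_distrib_right mult.assoc)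
  qed
  then show ?thesis by (simp add: L_diff L_sum L_cmult)
qed

text \<open>Expanding factor by factor never increases the degree bound. Once no factor is left, an
  exponent sum below \<open>n * d\<close> forces some exponent below \<open>d\<close>.\<close>

lemma L_low_degree:
  assumes "(\<Sum>i<n. e i) + length fs < n * d"
  shows "L (\<lambda>a. monomial n e a * (\<Prod>(\<beta>, c)\<leftarrow>fs. linform n \<beta> a - c)) = 0"
  using assms
proof (induction fs arbitrary: e)
  case Nil
  have "\<exists>i<n. e i < d"
  proof (rule ccontr)
    assume "\<not> ?thesis"
    then have "(\<Sum>i<n. d) \<le> (\<Sum>i<n. e i)" by (intro sum_mono) auto
    with Nil show False by simp
  qed
  then show ?case using L_monomial_eq_0 by auto
next
  case (Cons f fs)
  obtain \<beta> c where f: "f = (\<beta>, c)" by fastforce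
  have "L (\<lambda>a. monomial n (e(i := Suc (e i))) a * (\<Prod>(\<beta>, c)\<leftarrow>fs. linform n \<beta> a - c)) = 0"
    if "i < n" for i
    by (rule Cons.IH, subst sum_exponent_Suc[OF that]) (use Cons.prems in simp)
  moreover have "L (\<lambda>a. monomial n e a * (\<Prod>(\<beta>, c)\<leftarrow>fs. linform n \<beta> a - c)) = 0"
    by (rule Cons.IH) (use Cons.prems in simp)
  ultimately show ?case
    by (simp add: f L_affine_mult)
qed

text \<open>Choosing the constant from a factor drops the degree below \<open>n * d\<close>, where
  \<open>L\<close> vanishes. Only the leading form matters.\<close>

lemma L_drop_constants:
  assumes "(\<Sum>i<n. e i) + length fs \<le> n * d"
  shows "L (\<lambda>a. monomial n e a * (\<Prod>(\<beta>, c)\<leftarrow>fs. linform n \<beta> a - c)) =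
         L (\<lambda>a. monomial n e a * (\<Prod>(\<beta>, c)\<leftarrow>fs. linform n \<beta> a))"
  using assms
proof (induction fs arbitrary: e)
  case (Cons f fs)
  obtain \<beta> c where f: "f = (\<beta>, c)" by fastforce
  have "L (\<lambda>a. monomial n (e(i := Suc (e i))) a * (\<Prod>(\<beta>, c)\<leftarrow>fs. linform n \<beta> a - c)) =
        L (\<lambda>a. monomial n (e(i := Suc (e i))) a * (\<Prod>(\<beta>, c)\<leftarrow>fs. linform n \<beta> a))"
    if "i < n" for i
    by (rule Cons.IH, subst sum_exponent_Suc[OF that]) (use Cons.prems in simp)
  moreover have "L (\<lambda>a. monomial n e a * (\<Prod>(\<beta>, c)\<leftarrow>fs. linform n \<beta> a - c)) = 0"
    by (rule L_low_degree) (use Cons.prems in simp)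
  ultimately show ?case
    \<comment> \<open>The instance with constant 0 expands the homogeneous product on the right-hand
      side.\<close>
    using L_affine_mult[of e \<beta> 0 "\<lambda>a. \<Prod>(\<beta>, c)\<leftarrow>fs. linform n \<beta> a"]
    by (simp add: f L_affine_mult)
qed simp

text \<open>With the convention \<open>1 / t! = 0\<close> for \<open>t < 0\<close>, this is \<open>1 / (d - m)!\<close>, so that
  \<open>rfact_Suc\<close> holds for all \<open>m\<close>.\<close>

definition rfact :: "nat \<Rightarrow> real" where
  "rfact m = (if m \<le> d then 1 / fact (d - m) else 0)"

lemma rfact_Suc: "rfact (Suc m) = (real d - real m) * rfact m"
proof (cases "m < d")
  case True
  then obtain t where t: "d - m = Suc t" by (metis Suc_diff_Suc)
  then have "d - Suc m = t" "real d - real m = real (Suc t)" using True by (auto simp: of_nat_diff[symmetric])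
  then show ?thesis using True t by (simp add: rfact_def)
qed (auto simp: rfact_def)

text \<open>The product is a falling factorial: a monic polynomial of degree \<open>j\<close> in
  \<open>d - i\<close>, which is what links these numbers to a Vandermonde determinant.\<close>

lemma rfact_add: "rfact (i + j) = rfact i * (\<Prod>l<j. real d - real i - real l)"
  by (induction j) (simp_all add: rfact_Suc mult_ac diff_diff_eq)

text \<open>This is the multinomial coefficient of the complementary monomial with exponents
  \<open>d - e i\<close>; it is 0 on both sides if some \<open>e i\<close> exceeds
  \<open>d\<close>.\<close>

lemma L_monomial_mult_power_sum:
  assumes "(\<Sum>i<n. e i) + N = n * d"
  shows "L (\<lambda>a. monomial n e a * (\<Sum>i<n. a i) ^ N) = fact N * (\<Prod>i<n. rfact (e i))"
  using assms
proof (induction N arbitrary: e)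
  case 0
  show ?case
  \<comment> \<open>The exponents sum to \<open>n * d\<close>, so one below \<open>d\<close> forces
    another above \<open>d\<close> and both sides vanish; otherwise all equal
    \<open>d\<close>.\<close>
  proof (cases "\<exists>i<n. e i < d")
    case True
    then have "\<exists>i<n. e i > d"
    proof (rule contrapos_pp)
      assume "\<not> (\<exists>i<n. e i > d)"
      then have "e i \<le> d" if "i < n" for i
        using that by force
      then have "(\<Sum>i<n. d - e i) = 0"
        using 0 by (subst sum_subtractf_nat) auto
      then show "\<not> (\<exists>i<n. e i < d)" by (force simp: not_less)
    qed
    then have "(\<Prod>i<n. rfact (e i)) = 0"
      by (intro prod_zero) (auto simp: rfact_def intro!: bexI)
    then show ?thesis using True L_monomial_eq_0 by auto
  next
    case False
    then have ge: "d \<le> e i" if "i < n" for i using that by force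
    then have "(\<Sum>i<n. e i - d) = 0"
      using 0 by (subst sum_subtractf_nat) auto
    with ge have "e i = d" if "i < n" for i using that by force
    then show ?thesis by (simp add: L_monomial weights rfact_def)
  qed
next
  case (Suc N)
  have "L (\<lambda>a. monomial n e a * (\<Sum>i<n. a i) ^ Suc N)
      = (\<Sum>i<n. L (\<lambda>a. monomial n (e(i := Suc (e i))) a * (\<Sum>i<n. a i) ^ N))"
    using L_affine_mult[of e "\<lambda>_. 1" 0 "\<lambda>a. (\<Sum>i<n. a i) ^ N"] by (simp add: linform_def)
  also have "\<dots> = (\<Sum>i<n. fact N * ((real d - real (e i)) * (\<Prod>l<n. rfact (e l))))"
  proof (rule sum.cong)
    fix i assume "i \<in> {..<n}"
    then have i: "i < n" by simp
    have "L (\<lambda>a. monomial n (e(i := Suc (e i))) a * (\<Sum>i<n. a i) ^ N)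
        = fact N * (\<Prod>l<n. rfact ((e(i := Suc (e i))) l))"
      by (rule Suc.IH, subst sum_exponent_Suc[OF i]) (use Suc.prems in simp)
    also have "(\<Prod>l<n. rfact ((e(i := Suc (e i))) l))
        = (\<Prod>l<n. (if l = i then real d - real (e i) else 1) * rfact (e l))"
      by (intro prod.cong) (auto simp: rfact_Suc)
    also have "\<dots> = (real d - real (e i)) * (\<Prod>l<n. rfact (e l))"
      using i by (simp add: prod.distrib)
    finally show "L (\<lambda>a. monomial n (e(i := Suc (e i))) a * (\<Sum>i<n. a i) ^ N)
        = fact N * ((real d - real (e i)) * (\<Prod>l<n. rfact (e l)))" .
  qed simp
  \<comment> \<open>The factors \<open>d - e i\<close> sum to \<open>Suc N\<close>, which turns
    \<open>fact N\<close> into \<open>fact (Suc N)\<close>.\<close>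
  also have "\<dots> = fact N * (real (n * d) - real (\<Sum>i<n. e i)) * (\<Prod>l<n. rfact (e l))"
    by (simp add: sum_distrib_left[symmetric] sum_distrib_right[symmetric] sum_subtractf)
  also have "real (n * d) - real (\<Sum>i<n. e i) = real (Suc N)"
    unfolding Suc.prems[symmetric] by simp
  finally show ?case by (simp add: mult_ac)
qed

text \<open>Taking \<open>rfact i\<close> out of row \<open>i\<close> leaves monic polynomials
  evaluated at the distinct nodes \<open>d - i\<close>. The bound on \<open>n\<close> keeps every
  \<open>rfact i\<close> nonzero.\<close>

lemma det_rfact_neq_0:
  assumes "n \<le> Suc d"
  shows "(\<Sum>\<sigma> | \<sigma> permutes {..<n}. of_int (sign \<sigma>) * (\<Prod>i<n. rfact (i + \<sigma> i))) \<noteq> 0"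
proof -
  define p :: "nat \<Rightarrow> real poly" where "p j = (\<Prod>l<j. [:- real l, 1:])" for j
  define x where "x i = real d - real i" for i
  have rfact: "rfact (i + j) = rfact i * poly (p j) (x i)" for i j
    by (simp add: rfact_add p_def x_def poly_prod)
  have "(\<Sum>\<sigma> | \<sigma> permutes {..<n}. of_int (sign \<sigma>) * (\<Prod>i<n. rfact (i + \<sigma> i)))
      = (\<Prod>i<n. rfact i) * (\<Sum>\<sigma> | \<sigma> permutes {..<n}. of_int (sign \<sigma>) * (\<Prod>i<n. poly (p (\<sigma> i)) (x i)))"
    by (simp add: rfact prod.distrib sum_distrib_left mult_ac)
  also have "(\<Sum>\<sigma> | \<sigma> permutes {..<n}. of_int (sign \<sigma>) * (\<Prod>i<n. poly (p (\<sigma> i)) (x i)))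
      = det (mat n n (\<lambda>(i, j). poly (p j) (x i)))"
    by (simp only: det_mat_sum_permutations)
  also have "\<dots> = det (mat n n (\<lambda>(i, j). x i ^ j))"
  proof (rule det_monic_columns)
    show "degree (p j) = j" for j
      by (simp add: p_def degree_prod_sum_eq)
    show "lead_coeff (p j) = 1" for j
      by (simp add: p_def lead_coeff_prod)
  qed
  also have "\<dots> = (\<Prod>j<n. \<Prod>i<j. x j - x i)"
    by (rule det_vandermonde)
  also have "(\<Prod>i<n. rfact i) * \<dots> \<noteq> 0"
    using assms by (auto simp: x_def rfact_def)
  finally show ?thesis .
qed

lemma L_vandermonde_product:
  assumes N: "n * (n - 1) + N = n * d"
  shows "L (\<lambda>a. (\<Prod>j<n. \<Prod>i<j. \<alpha> j * a j - \<alpha> i * a i) * (\<Prod>j<n. \<Prod>i<j. a j - a i) * (\<Sum>i<n. a i) ^ N)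
    = fact N * (\<Sum>\<tau> | \<tau> permutes {..<n}. \<Prod>i<n. \<alpha> i ^ \<tau> i) *
      (\<Sum>\<sigma> | \<sigma> permutes {..<n}. of_int (sign \<sigma>) * (\<Prod>i<n. rfact (i + \<sigma> i)))"
proof -
  let ?P = "{\<sigma>. \<sigma> permutes {..<n}}"
  let ?s = "\<lambda>\<sigma>. of_int (sign (\<sigma> :: nat \<Rightarrow> nat)) :: real"
  let ?D = "\<Sum>\<sigma>\<in>?P. ?s \<sigma> * (\<Prod>i<n. rfact (i + \<sigma> i))"
  have sum_perm: "(\<Sum>i<n. \<sigma> i) = (\<Sum>i<n. i)" if "\<sigma> \<in> ?P" for \<sigma> :: "nat \<Rightarrow> nat"
    using sum.permute[of \<sigma> "{..<n}" "\<lambda>i. i"] that by simp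
  \<comment> \<open>Every term of the double expansion has degree exactly \<open>n * d\<close>, as
    the multinomial evaluation requires.\<close>
  have deg: "(\<Sum>i<n. \<tau> i + \<sigma> i) + N = n * d" if "\<tau> \<in> ?P" "\<sigma> \<in> ?P" for \<tau> \<sigma>
  proof -
    have "(\<Sum>i<n. i) + (\<Sum>i<n. i) = n * (n - 1)"
      by (induction n) (auto simp: algebra_simps)
    then show ?thesis using sum_perm that N by (simp add: sum.distrib)
  qed
  have "L (\<lambda>a. (\<Prod>j<n. \<Prod>i<j. \<alpha> j * a j - \<alpha> i * a i) * (\<Prod>j<n. \<Prod>i<j. a j - a i) * (\<Sum>i<n. a i) ^ N)
      = L (\<lambda>a. \<Sum>\<tau>\<in>?P. \<Sum>\<sigma>\<in>?P. ?s \<tau> * ?s \<sigma> * (\<Prod>i<n. \<alpha> i ^ \<tau> i) *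
            (monomial n (\<lambda>i. \<tau> i + \<sigma> i) a * (\<Sum>i<n. a i) ^ N))"
    unfolding vandermonde_sum_permutations vandermonde_sum_permutations[of "\<lambda>i. \<alpha> i * _ i"]
      sum_product sum_distrib_right monomial_def
    by (intro L_cong sum.cong refl) (simp add: sum_distrib_left power_add prod.distrib power_mult_distrib mult_ac)
  also have "\<dots> = (\<Sum>\<tau>\<in>?P. \<Sum>\<sigma>\<in>?P. ?s \<tau> * ?s \<sigma> * (\<Prod>i<n. \<alpha> i ^ \<tau> i) *
            (fact N * (\<Prod>i<n. rfact (\<tau> i + \<sigma> i))))"
    by (simp add: L_sum L_cmult L_monomial_mult_power_sum deg)
  also have "\<dots> = (\<Sum>\<tau>\<in>?P. (\<Prod>i<n. \<alpha> i ^ \<tau> i) * fact N * ?D)"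
  proof (rule sum.cong)
    fix \<tau> assume "\<tau> \<in> ?P"
    then have \<tau>: "\<tau> permutes {..<n}" by simp
    \<comment> \<open>Substituting \<open>\<rho> \<circ> \<tau>\<close> for \<open>\<sigma>\<close>
      leaves only the sign of \<open>\<rho>\<close>, and reindexing the product by
      \<open>\<tau>\<close> removes \<open>\<tau>\<close>. The double sum splits into a permanent
      times a determinant.\<close>
    have "(\<Sum>\<sigma>\<in>?P. ?s \<tau> * ?s \<sigma> * (\<Prod>i<n. rfact (\<tau> i + \<sigma> i)))
        = (\<Sum>\<rho>\<in>?P. ?s \<tau> * ?s (\<rho> \<circ> \<tau>) * (\<Prod>i<n. rfact (\<tau> i + (\<rho> \<circ> \<tau>) i)))"
      by (rule sum_permutations_compose_right[OF \<tau>])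
    also have "\<dots> = ?D"
    proof (rule sum.cong)
      fix \<rho> assume "\<rho> \<in> ?P"
      then have \<rho>: "\<rho> permutes {..<n}" by simp
      have "sign (\<rho> \<circ> \<tau>) = sign \<rho> * sign \<tau>"
        using \<tau> \<rho> by (intro sign_compose) (auto simp: permutation_permutes)
      then have "?s \<tau> * ?s (\<rho> \<circ> \<tau>) = ?s \<rho>"
        by (simp add: sign_def)
      moreover have "(\<Prod>i<n. rfact (\<tau> i + (\<rho> \<circ> \<tau>) i)) = (\<Prod>i<n. rfact (i + \<rho> i))"
        using prod.permute[OF \<tau>, of "\<lambda>i. rfact (i + \<rho> i)"] by (simp add: o_def)
      ultimately show "?s \<tau> * ?s (\<rho> \<circ> \<tau>) * (\<Prod>i<n. rfact (\<tau> i + (\<rho> \<circ> \<tau>) i)) = ?s \<rho> * (\<Prod>i<n. rfact (i + \<rho> i))"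
        by simp
    qed simp
    finally have "(\<Prod>i<n. \<alpha> i ^ \<tau> i) * fact N * (\<Sum>\<sigma>\<in>?P. ?s \<tau> * ?s \<sigma> * (\<Prod>i<n. rfact (\<tau> i + \<sigma> i)))
        = (\<Prod>i<n. \<alpha> i ^ \<tau> i) * fact N * ?D"
      by (rule arg_cong)
    then show "(\<Sum>\<sigma>\<in>?P. ?s \<tau> * ?s \<sigma> * (\<Prod>i<n. \<alpha> i ^ \<tau> i) * (fact N * (\<Prod>i<n. rfact (\<tau> i + \<sigma> i))))
        = (\<Prod>i<n. \<alpha> i ^ \<tau> i) * fact N * ?D"
      by (simp add: sum_distrib_left mult_ac)
  qed simp
  also have "\<dots> = fact N * (\<Sum>\<tau>\<in>?P. \<Prod>i<n. \<alpha> i ^ \<tau> i) * ?D"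
    by (simp only: sum_distrib_right[symmetric]) simp
  finally show ?thesis .
qed

end

section \<open>Restricted sumsets\<close>

text \<open>Real, zero-based form of the theorem, with each congruence replaced by one forbidden
  difference \<open>c i j\<close>. The contradiction comes from evaluating \<open>L\<close> on a
  product of degree \<open>n * d\<close> in two ways.\<close>

lemma card_restricted_sumset:
  fixes A :: "nat \<Rightarrow> real set" and \<alpha> :: "nat \<Rightarrow> real" and c :: "nat \<Rightarrow> nat \<Rightarrow> real"
  assumes "n \<le> k" "1 \<le> k" and \<alpha>: "\<And>i. i < n \<Longrightarrow> \<alpha> i > 0"
    and A: "\<And>i. i < n \<Longrightarrow> finite (A i)" "\<And>i. i < n \<Longrightarrow> card (A i) = k"
  shows "(k - n) * n < card {(\<Sum>i<n. a i) | a. (\<forall>i<n. a i \<in> A i) \<and>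
           (\<forall>j<n. \<forall>i<j. \<alpha> j * a j \<noteq> \<alpha> i * a i \<and> a j - a i \<noteq> c i j)}"
    (is "?N < card ?S")
proof (rule ccontr)
  assume "\<not> ?thesis"
  then have small: "card ?S \<le> ?N" by simp
  define d where "d = k - 1"
  have k: "k = Suc d" using assms by (simp add: d_def)
  have "\<exists>w. \<forall>m<card (A i). (\<Sum>a\<in>A i. w a * a ^ m) = of_bool (Suc m = card (A i))" if "i < n" for i
    using A[OF that] k by (intro top_coefficient_weights) auto
  then have "\<forall>i\<in>{..<n}. \<exists>w. \<forall>m\<le>d. (\<Sum>a\<in>A i. w a * a ^ m) = of_bool (m = d)"
    using A k by (simp add: less_Suc_eq_le)
  then obtain w where w: "\<forall>i\<in>{..<n}. \<forall>m\<le>d. (\<Sum>a\<in>A i. w i a * a ^ m) = of_bool (m = d)"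
    by (rule bchoice[THEN exE])
  interpret weighted_grid n d A w
    using A w by unfold_locales auto

  have "?S \<subseteq> (\<lambda>a. \<Sum>i<n. a i) ` PiE {..<n} A"
  proof
    fix s assume "s \<in> ?S"
    then obtain a where "s = (\<Sum>i<n. a i)" "\<forall>i<n. a i \<in> A i" by blast
    then show "s \<in> (\<lambda>a. \<Sum>i<n. a i) ` PiE {..<n} A"
      by (intro image_eqI[of _ _ "restrict a {..<n}"]) auto
  qed
  then have "finite ?S"
    by (rule finite_subset) (auto intro!: finite_imageI finite_PiE A)
  \<comment> \<open>Padding with zeros gives the list length exactly \<open>?N\<close>, so that the
    product reaches degree \<open>n * d\<close>; extra factors do not spoil its vanishing on the
    grid.\<close>
  then obtain es where es: "?S \<subseteq> set es" "length es = ?N"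
    using small by (intro that[of "sorted_list_of_set ?S @ replicate (?N - card ?S) 0"]) auto
  obtain ps where ps: "set ps = Sigma {..<n} lessThan" "distinct ps"
    using finite_distinct_list[of "Sigma {..<n} lessThan"] by auto
  have prod_ps: "(\<Prod>(j, i)\<leftarrow>ps. f j i) = (\<Prod>j<n. \<Prod>i<j. f j i)" for f :: "nat \<Rightarrow> nat \<Rightarrow> real"
    by (subst prod.distinct_set_conv_list[OF ps(2), symmetric]) (simp add: ps prod.Sigma)
  have "length ps = (\<Sum>j<n. j)"
    using distinct_card[OF ps(2)] ps(1) by simp
  moreover have "(\<Sum>j<n. j) + (\<Sum>j<n. j) = n * (n - 1)"
    by (induction n) (auto simp: algebra_simps)
  ultimately have len_ps: "length ps + length ps = n * (n - 1)" by simp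
  have N: "n * (n - 1) + ?N = n * d"
  proof -
    obtain t where "k = n + t" using \<open>n \<le> k\<close> le_Suc_ex by blast
    then show ?thesis by (cases n) (auto simp: d_def algebra_simps)
  qed

  \<comment> \<open>Coefficient vector of the linear form \<open>u * a j - v * a i\<close>.\<close>
  define \<beta> where "\<beta> u v j i = (\<lambda>l. (if l = j then u else 0) - (if l = i then v else 0 :: real))"
    for u v and j i :: nat
  have \<beta>: "linform n (\<beta> u v j i) a = u * a j - v * a i" if "(j, i) \<in> set ps" for u v j i a
  proof -
    have "i < n" "j < n" using that ps by auto
    then show ?thesis
      by (simp add: linform_def \<beta>_def left_diff_distrib sum_subtractf if_distrib[of "\<lambda>x. x * _"] cong: if_cong)
  qed
  define fs where "fs = map (\<lambda>(j, i). (\<beta> (\<alpha> j) (\<alpha> i) j i, 0)) ps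
    @ map (\<lambda>(j, i). (\<beta> 1 1 j i, c i j)) ps @ map (\<lambda>e. (\<lambda>_. 1, e)) es"
  have "(\<Prod>(\<beta>, c)\<leftarrow>fs. linform n \<beta> a - c) =
      (\<Prod>(j, i)\<leftarrow>ps. \<alpha> j * a j - \<alpha> i * a i) * (\<Prod>(j, i)\<leftarrow>ps. a j - a i - c i j) *
      (\<Prod>e\<leftarrow>es. (\<Sum>i<n. a i) - e)" for a
    unfolding fs_def
    by (auto simp: o_def \<beta> linform_def[of _ "\<lambda>_. 1"] case_prod_beta
             intro!: arg_cong2[where f="(*)"] arg_cong[where f=prod_list])
  moreover have "(\<Prod>(\<beta>, c)\<leftarrow>fs. linform n \<beta> a) =
      (\<Prod>(j, i)\<leftarrow>ps. \<alpha> j * a j - \<alpha> i * a i) * (\<Prod>(j, i)\<leftarrow>ps. a j - a i) *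
      (\<Prod>e\<leftarrow>es. \<Sum>i<n. a i)" for a
    unfolding fs_def
    by (auto simp: o_def \<beta> linform_def[of _ "\<lambda>_. 1"] case_prod_beta
             intro!: arg_cong2[where f="(*)"] arg_cong[where f=prod_list])
  moreover have "L (\<lambda>a. monomial n (\<lambda>_. 0) a * (\<Prod>(\<beta>, c)\<leftarrow>fs. linform n \<beta> a - c)) =
      L (\<lambda>a. monomial n (\<lambda>_. 0) a * (\<Prod>(\<beta>, c)\<leftarrow>fs. linform n \<beta> a))"
    by (rule L_drop_constants) (use len_ps N es in \<open>simp add: fs_def\<close>)
  ultimately have "L (\<lambda>a. (\<Prod>j<n. \<Prod>i<j. \<alpha> j * a j - \<alpha> i * a i) *
        (\<Prod>j<n. \<Prod>i<j. a j - a i - c i j) * (\<Prod>e\<leftarrow>es. (\<Sum>i<n. a i) - e)) =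
      L (\<lambda>a. (\<Prod>j<n. \<Prod>i<j. \<alpha> j * a j - \<alpha> i * a i) * (\<Prod>j<n. \<Prod>i<j. a j - a i) * (\<Sum>i<n. a i) ^ ?N)"
    by (simp add: prod_ps monomial_def es(2) map_replicate_const)
  also have "\<dots> = fact ?N * (\<Sum>\<tau> | \<tau> permutes {..<n}. \<Prod>i<n. \<alpha> i ^ \<tau> i) *
      (\<Sum>\<sigma> | \<sigma> permutes {..<n}. of_int (sign \<sigma>) * (\<Prod>i<n. rfact (i + \<sigma> i)))"
    using N by (rule L_vandermonde_product)
  also have "\<dots> \<noteq> 0"
  proof -
    have "(\<Sum>\<tau> | \<tau> permutes {..<n}. \<Prod>i<n. \<alpha> i ^ \<tau> i) > 0"
      using \<alpha> by (intro sum_pos prod_pos) (auto simp: finite_permutations intro: permutes_id)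
    then show ?thesis using det_rfact_neq_0 \<open>n \<le> k\<close> k by simp
  qed
  also have "L (\<lambda>a. (\<Prod>j<n. \<Prod>i<j. \<alpha> j * a j - \<alpha> i * a i) *
        (\<Prod>j<n. \<Prod>i<j. a j - a i - c i j) * (\<Prod>e\<leftarrow>es. (\<Sum>i<n. a i) - e)) = L (\<lambda>_. 0)"
  proof (rule L_cong)
    fix a assume a: "a \<in> PiE {..<n} A"
    show "(\<Prod>j<n. \<Prod>i<j. \<alpha> j * a j - \<alpha> i * a i) * (\<Prod>j<n. \<Prod>i<j. a j - a i - c i j) *
        (\<Prod>e\<leftarrow>es. (\<Sum>i<n. a i) - e) = 0"
    \<comment> \<open>At an admissible point the sum occurs in \<open>es\<close>; at any other point
      a factor belonging to a pair vanishes.\<close>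
    proof (cases "\<forall>j<n. \<forall>i<j. \<alpha> j * a j \<noteq> \<alpha> i * a i \<and> a j - a i \<noteq> c i j")
      case True
      then have "(\<Sum>i<n. a i) \<in> ?S" using a by blast
      then show ?thesis using es(1) by (auto simp: prod_list_zero_iff)
    next
      case False
      then show ?thesis by auto
    qed
  qed
  finally show False by (simp add: L_def)
qed

section \<open>Reduction of the integer statement to real restricted sumsets\<close>

theorem theorem1p3:
  fixes n k :: nat
    and \<alpha> :: "nat \<Rightarrow> real"
    and b :: "nat \<Rightarrow> int"
    and A :: "nat \<Rightarrow> int set"
    and m :: "nat \<Rightarrow> nat \<Rightarrow> int"
  assumes "n \<ge> 1" and "k \<ge> 1"
    and "\<forall>i\<in>{1..n}. \<alpha> i > 0"
    and "\<forall>i\<in>{1..n}. finite (A i) \<and> card (A i) = k"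
    and "\<forall>i\<in>{1..n}. \<forall>j\<in>{1..n}. i < j \<longrightarrow>
           m i j > 2 * Max {\<bar>x - y\<bar> | x y. x \<in> A i \<and> y \<in> A j}"
  shows "int (card {(\<Sum>i=1..n. a i) | a :: nat \<Rightarrow> int.
            (\<forall>i\<in>{1..n}. a i \<in> A i) \<and>
            (\<forall>i\<in>{1..n}. \<forall>j\<in>{1..n}. i < j \<longrightarrow>
               of_int (a i) * \<alpha> i \<noteq> of_int (a j) * \<alpha> j \<and>
               \<not> [a i + b i = a j + b j] (mod m i j))})
         > (int k - int n) * int n"
proof (cases "n \<le> k")
  case False
  then have "(int k - int n) * int n < 0"
    using assms(1) by (simp add: mult_neg_pos)
  then show ?thesis by linarith
next
  case True
  let ?T = "{(\<Sum>i=1..n. a i) | a :: nat \<Rightarrow> int.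
            (\<forall>i\<in>{1..n}. a i \<in> A i) \<and>
            (\<forall>i\<in>{1..n}. \<forall>j\<in>{1..n}. i < j \<longrightarrow>
               of_int (a i) * \<alpha> i \<noteq> of_int (a j) * \<alpha> j \<and>
               \<not> [a i + b i = a j + b j] (mod m i j))}"
  have "\<exists>c. \<forall>x\<in>A i. \<forall>y\<in>A j. [x + b i = y + b j] (mod m i j) \<longrightarrow> y - x = c"
    if "i \<in> {1..n}" "j \<in> {1..n}" "i < j" for i j
  proof -
    let ?M = "Max {\<bar>x - y\<bar> | x y. x \<in> A i \<and> y \<in> A j}"
    have "finite ((\<lambda>(x, y). \<bar>x - y\<bar>) ` (A i \<times> A j))"
      using assms(4) that by auto
    also have "(\<lambda>(x, y). \<bar>x - y\<bar>) ` (A i \<times> A j) = {\<bar>x - y\<bar> | x y. x \<in> A i \<and> y \<in> A j}"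
      by auto
    finally have le: "\<bar>x - y\<bar> \<le> ?M" if "x \<in> A i" "y \<in> A j" for x y
      using that by (intro Max_ge) auto
    \<comment> \<open>Two congruent pairs have differences that agree modulo \<open>m i j\<close>
      and lie at distance at most \<open>2 * ?M < m i j\<close>, hence coincide.\<close>
    have "y - x = y' - x'" if "x \<in> A i" "y \<in> A j" "x' \<in> A i" "y' \<in> A j"
      and cong: "[x + b i = y + b j] (mod m i j)" "[x' + b i = y' + b j] (mod m i j)" for x y x' y'
    proof -
      have "m i j dvd (x + b i - (y + b j)) - (x' + b i - (y' + b j))"
        using cong unfolding cong_iff_dvd_diff by (rule dvd_diff)
      then have dvd: "m i j dvd (x - y) - (x' - y')" by (simp add: algebra_simps)
      have "\<bar>(x - y) - (x' - y')\<bar> < m i j"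
        using le[of x y] le[of x' y'] that assms(5) \<open>i \<in> {1..n}\<close> \<open>j \<in> {1..n}\<close> \<open>i < j\<close> by fastforce
      with dvd have "(x - y) - (x' - y') = 0"
        using dvd_imp_le_int[of "(x - y) - (x' - y')" "m i j"] by linarith
      then show ?thesis by simp
    qed
    then show ?thesis by meson
  qed
  then obtain c where c: "\<And>i j x y. \<lbrakk>i \<in> {1..n}; j \<in> {1..n}; i < j; x \<in> A i; y \<in> A j;
      [x + b i = y + b j] (mod m i j)\<rbrakk> \<Longrightarrow> y - x = c i j"
    by metis
  \<comment> \<open>The index shift passes from \<open>{1..n}\<close> to \<open>{..<n}\<close>; it
    is undone below by reading \<open>a (i - 1)\<close>.\<close>
  define B where "B i = real_of_int ` A (Suc i)" for i
  let ?S = "{(\<Sum>i<n. a i) | a. (\<forall>i<n. a i \<in> B i) \<and>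
      (\<forall>j<n. \<forall>i<j. \<alpha> (Suc j) * a j \<noteq> \<alpha> (Suc i) * a i \<and> a j - a i \<noteq> of_int (c (Suc i) (Suc j)))}"
  have "(k - n) * n < card ?S"
    using True assms
    by (intro card_restricted_sumset[where \<alpha> = "\<lambda>i. \<alpha> (Suc i)" and c = "\<lambda>i j. of_int (c (Suc i) (Suc j))"])
       (auto simp: B_def card_image inj_on_def)
  also have "card ?S \<le> card (real_of_int ` ?T)"
  proof (rule card_mono)
    have "?T \<subseteq> (\<lambda>a. \<Sum>i=1..n. a i) ` PiE {1..n} A"
    proof
      fix s assume "s \<in> ?T"
      then obtain a where "s = (\<Sum>i=1..n. a i)" "\<forall>i\<in>{1..n}. a i \<in> A i" by blast
      then show "s \<in> (\<lambda>a. \<Sum>i=1..n. a i) ` PiE {1..n} A"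
        by (intro image_eqI[of _ _ "restrict a {1..n}"]) auto
    qed
    then have "finite ?T"
      by (rule finite_subset) (use assms(4) in \<open>auto intro!: finite_imageI finite_PiE\<close>)
    then show "finite (real_of_int ` ?T)" by (rule finite_imageI)
    \<comment> \<open>If no pair is congruent, \<open>c\<close> is arbitrary and \<open>?S\<close>
      may be strictly smaller. The inclusion suffices for a lower bound on
      \<open>?T\<close>.\<close>
    show "?S \<subseteq> real_of_int ` ?T"
    proof
      fix s assume "s \<in> ?S"
      then obtain a where s: "s = (\<Sum>i<n. a i)" and aB: "\<And>i. i < n \<Longrightarrow> a i \<in> B i"
        and a: "\<And>i j. j < n \<Longrightarrow> i < j \<Longrightarrow> \<alpha> (Suc j) * a j \<noteq> \<alpha> (Suc i) * a i"
          "\<And>i j. j < n \<Longrightarrow> i < j \<Longrightarrow> a j - a i \<noteq> of_int (c (Suc i) (Suc j))"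
        by blast
      have "\<forall>i\<in>{1..n}. \<exists>x. x \<in> A i \<and> a (i - 1) = of_int x"
      proof
        fix i assume "i \<in> {1..n}"
        then have "i - 1 < n" "Suc (i - 1) = i" by auto
        then show "\<exists>x. x \<in> A i \<and> a (i - 1) = of_int x"
          using aB[of "i - 1"] unfolding B_def by auto
      qed
      then obtain x where x: "\<And>i. i \<in> {1..n} \<Longrightarrow> x i \<in> A i \<and> a (i - 1) = of_int (x i)"
        by metis
      have "s = of_int (\<Sum>i=1..n. x i)"
      proof -
        have "s = (\<Sum>i=1..n. a (i - 1))"
          unfolding s by (rule sum.reindex_bij_witness[of _ "\<lambda>i. i - 1" Suc]) auto
        then show ?thesis using x by simp
      qed
      moreover have "of_int (x i) * \<alpha> i \<noteq> of_int (x j) * \<alpha> j \<and> \<not> [x i + b i = x j + b j] (mod m i j)"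
        if "i \<in> {1..n}" "j \<in> {1..n}" "i < j" for i j
      proof
        have ij: "j - 1 < n" "i - 1 < j - 1" "Suc (i - 1) = i" "Suc (j - 1) = j" using that by auto
        show "of_int (x i) * \<alpha> i \<noteq> of_int (x j) * \<alpha> j"
          using a(1)[OF ij(1,2)] x that unfolding ij(3,4) by (simp add: mult.commute)
        have "real_of_int (x j - x i) \<noteq> of_int (c i j)"
          using a(2)[OF ij(1,2)] x that unfolding ij(3,4) by simp
        then show "\<not> [x i + b i = x j + b j] (mod m i j)"
          using c[OF that, of "x i" "x j"] x that by auto
      qed
      ultimately show "s \<in> real_of_int ` ?T" using x by blast
    qed
  qed
  also have "\<dots> = card ?T"
    by (rule card_image) (simp add: inj_on_def)
  finally have "int ((k - n) * n) < int (card ?T)"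
    unfolding of_nat_less_iff .
  moreover have "int ((k - n) * n) = (int k - int n) * int n"
    using True by (simp add: of_nat_diff)
  ultimately show ?thesis by (simp only:)
qed

end
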